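(* Let $\lambda\neq0$ be a real number. A smooth vector field on $(H_3,g_2)$ is a matter collineation if and only if it is a Killing vector field of $(H_3,g_2)$.
   Context: The Heisenberg group $H_3$ is $\mathbb{R}^3$ with global coordinates $(x,y,z)$ and multiplication $(x,y,z)(\tilde x,\tilde y,\tilde z)=(x+\tilde x,y+\tilde y,z+\tilde z-x\tilde y)$. For $\lambda\neq0$, $g_2$ is the left-invariant Lorentzian metric $g_2=\frac{1}{\lambda^2}dx^2+dy^2-(x\,dy+dz)^2$. With $R(X,Y)=[\nabla_X,\nabla_Y]-\nabla_{[X,Y]}$ the curvature tensor of the Levi-Civita connection, the Ricci tensor is $\varrho(X,Y)=\sum_k g(e_k,e_k)\,g(R(e_k,X)Y,e_k)$ for an orthonormal basis $\{e_k\}$, $\tau$ is the scalar curvature (the $g$-trace of $\varrho$), and $T=\varrho-\frac12\tau g$ is the energy-momentum tensor. A smooth vector field $X$ is Killing if $\mathcal{L}_Xg=0$ and a matter collineation if $\mathcal{L}_XT=0$. *)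

theory Defs
  imports "HOL-Analysis.Analysis"
begin

text \<open>
  Pseudo-Riemannian geometry on the manifold \<open>real ^ 'n\<close> in its global coordinates.  Every
  tangent space is identified with \<open>real ^ 'n\<close> through the coordinate frame, so that the
  vector \<open>axis i 1\<close> at \<open>p\<close> is the \<open>i\<close>-th coordinate vector.
\<close>

type_synonym 'n vfield = "real ^ 'n \<Rightarrow> real ^ 'n"
type_synonym 'n tensor2 = "real ^ 'n \<Rightarrow> real ^ 'n \<Rightarrow> real ^ 'n \<Rightarrow> real"

primrec Ck :: "nat \<Rightarrow> ('a::real_normed_vector \<Rightarrow> 'b::real_normed_vector) \<Rightarrow> bool" where
  "Ck 0 f \<longleftrightarrow> continuous_on UNIV f"
| "Ck (Suc k) f \<longleftrightarrow>
     (\<forall>p. f differentiable at p) \<and> (\<forall>v. Ck k (\<lambda>p. frechet_derivative f (at p) v))"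

definition smooth :: "('a::real_normed_vector \<Rightarrow> 'b::real_normed_vector) \<Rightarrow> bool" where
  "smooth f \<longleftrightarrow> (\<forall>k. Ck k f)"

definition dir_deriv :: "'n::finite vfield \<Rightarrow> (real ^ 'n \<Rightarrow> 'b::real_normed_vector) \<Rightarrow> real ^ 'n \<Rightarrow> 'b" where
  "dir_deriv X f p = frechet_derivative f (at p) (X p)"

abbreviation partial :: "'n::finite \<Rightarrow> (real ^ 'n \<Rightarrow> 'b::real_normed_vector) \<Rightarrow> real ^ 'n \<Rightarrow> 'b" where
  "partial i \<equiv> dir_deriv (\<lambda>_. axis i 1)"

definition lie_bracket :: "'n::finite vfield \<Rightarrow> 'n vfield \<Rightarrow> 'n vfield" where
  "lie_bracket X Y p = dir_deriv X Y p - dir_deriv Y X p"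

definition lie_derivative ::
  "'n::finite vfield \<Rightarrow> 'n tensor2 \<Rightarrow> 'n vfield \<Rightarrow> 'n vfield \<Rightarrow> real ^ 'n \<Rightarrow> real" where
  "lie_derivative X S Y Z p =
     dir_deriv X (\<lambda>q. S q (Y q) (Z q)) p
     - S p (lie_bracket X Y p) (Z p) - S p (Y p) (lie_bracket X Z p)"

definition gram :: "'n::finite tensor2 \<Rightarrow> real ^ 'n \<Rightarrow> real ^ 'n ^ 'n" where
  "gram g p = (\<chi> i j. g p (axis i 1) (axis j 1))"

definition christoffel :: "'n::finite tensor2 \<Rightarrow> 'n \<Rightarrow> 'n \<Rightarrow> 'n \<Rightarrow> real ^ 'n \<Rightarrow> real" where
  "christoffel g k i j p =
     (\<Sum>l\<in>UNIV. matrix_inv (gram g p) $ k $ l *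
        (partial i (\<lambda>q. gram g q $ j $ l) p
         + partial j (\<lambda>q. gram g q $ i $ l) p
         - partial l (\<lambda>q. gram g q $ i $ j) p)) / 2"

definition levi_civita :: "'n::finite tensor2 \<Rightarrow> 'n vfield \<Rightarrow> 'n vfield \<Rightarrow> 'n vfield" where
  "levi_civita g X Y p =
     dir_deriv X Y p
     + (\<chi> k. \<Sum>i\<in>UNIV. \<Sum>j\<in>UNIV. christoffel g k i j p * X p $ i * Y p $ j)"

definition curvature ::
  "'n::finite tensor2 \<Rightarrow> 'n vfield \<Rightarrow> 'n vfield \<Rightarrow> 'n vfield \<Rightarrow> 'n vfield" where
  "curvature g X Y Z p =
     levi_civita g X (levi_civita g Y Z) p - levi_civita g Y (levi_civita g X Z) p
     - levi_civita g (lie_bracket X Y) Z p"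

text \<open>
  The curvature is a tensor, so its value on tangent vectors \<open>u\<close>, \<open>v\<close>, \<open>w\<close> at \<open>p\<close> can be
  computed from any smooth extensions of these vectors; we take the constant ones.
\<close>

definition curvature_at ::
  "'n::finite tensor2 \<Rightarrow> real ^ 'n \<Rightarrow> real ^ 'n \<Rightarrow> real ^ 'n \<Rightarrow> real ^ 'n \<Rightarrow> real ^ 'n" where
  "curvature_at g p u v w = curvature g (\<lambda>_. u) (\<lambda>_. v) (\<lambda>_. w) p"

definition orthonormal_basis :: "('a \<Rightarrow> 'a \<Rightarrow> real) \<Rightarrow> ('n \<Rightarrow> 'a) \<Rightarrow> bool" where
  "orthonormal_basis b e \<longleftrightarrow>
     (\<forall>i. b (e i) (e i) = 1 \<or> b (e i) (e i) = - 1) \<and> (\<forall>i j. i \<noteq> j \<longrightarrow> b (e i) (e j) = 0)"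

text \<open>
  Ricci and scalar curvature do not depend on the orthonormal basis, so an arbitrary one is chosen.
\<close>

definition some_onb :: "'n::finite tensor2 \<Rightarrow> real ^ 'n \<Rightarrow> 'n \<Rightarrow> real ^ 'n" where
  "some_onb g p = (SOME e. orthonormal_basis (g p) e)"

definition ricci :: "'n::finite tensor2 \<Rightarrow> 'n tensor2" where
  "ricci g p u v =
     (\<Sum>k\<in>UNIV. let e = some_onb g p k in g p e e * g p (curvature_at g p e u v) e)"

definition scalar_curvature :: "'n::finite tensor2 \<Rightarrow> real ^ 'n \<Rightarrow> real" where
  "scalar_curvature g p =
     (\<Sum>k\<in>UNIV. let e = some_onb g p k in g p e e * ricci g p e e)"

definition energy_momentum :: "'n::finite tensor2 \<Rightarrow> 'n tensor2" where
  "energy_momentum g p u v = ricci g p u v - 1 / 2 * scalar_curvature g p * g p u v"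

definition killing :: "'n::finite tensor2 \<Rightarrow> 'n vfield \<Rightarrow> bool" where
  "killing g X \<longleftrightarrow> smooth X \<and>
     (\<forall>Y Z p. smooth Y \<longrightarrow> smooth Z \<longrightarrow> lie_derivative X g Y Z p = 0)"

definition matter_collineation :: "'n::finite tensor2 \<Rightarrow> 'n vfield \<Rightarrow> bool" where
  "matter_collineation g X \<longleftrightarrow> smooth X \<and>
     (\<forall>Y Z p. smooth Y \<longrightarrow> smooth Z \<longrightarrow> lie_derivative X (energy_momentum g) Y Z p = 0)"

definition heis_mult :: "real ^ 3 \<Rightarrow> real ^ 3 \<Rightarrow> real ^ 3" where
  "heis_mult p q = vector [p $ 1 + q $ 1, p $ 2 + q $ 2, p $ 3 + q $ 3 - p $ 1 * q $ 2]"

definition g2 :: "real \<Rightarrow> 3 tensor2" where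
  "g2 lam p u v =
     1 / lam\<^sup>2 * (u $ 1 * v $ 1) + u $ 2 * v $ 2
     - (p $ 1 * u $ 2 + u $ 3) * (p $ 1 * v $ 2 + v $ 3)"

lemma g2_left_invariant:
  "g2 lam (heis_mult a p) (frechet_derivative (heis_mult a) (at p) u)
     (frechet_derivative (heis_mult a) (at p) v) = g2 lam p u v"
proof -
  define L where "L = (\<lambda>h::real^3. vector [h $ 1, h $ 2, h $ 3 - a $ 1 * h $ 2] :: real^3)"
  have "(heis_mult a has_derivative L) (at p)"
    unfolding has_derivative_componentwise_within[of "heis_mult a"]
  proof
    fix b :: "real ^ 3" assume "b \<in> Basis"
    then consider "b = axis 1 1" | "b = axis 2 1" | "b = axis 3 1"
      by (auto simp: Basis_vec_def UNIV_3)
    then show "((\<lambda>q. heis_mult a q \<bullet> b) has_derivative (\<lambda>h. L h \<bullet> b)) (at p)"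
      by cases (auto simp: heis_mult_def L_def inner_axis
          intro!: derivative_eq_intros bounded_linear.has_derivative[OF bounded_linear_vec_nth])
  qed
  then have "frechet_derivative (heis_mult a) (at p) = L"
    by (rule frechet_derivative_at[symmetric])
  then show ?thesis
    by (simp add: L_def g2_def heis_mult_def algebra_simps)
qed

lemma g2_orthonormal_basis:
  assumes "lam \<noteq> 0"
  shows "orthonormal_basis (g2 lam p)
    (\<lambda>i :: 3. if i = 1 then vector [lam, 0, 0] else if i = 2 then vector [0, 1, - p $ 1]
         else vector [0, 0, 1] :: real ^ 3)"
  unfolding orthonormal_basis_def forall_3 using assms by (simp add: g2_def power2_eq_square)

text \<open>
  The connection is the Levi-Civita one: it is torsion-free and compatible with the metric.
\<close>

lemma levi_civita_torsion_free:
  assumes "\<And>p u v. g p u v = g p v u"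
  shows "levi_civita g X Y p - levi_civita g Y X p = lie_bracket X Y p"
proof -
  have gs: "gram g q $ i $ j = gram g q $ j $ i" for q i j
    by (simp add: gram_def assms)
  have c: "christoffel g k i j p = christoffel g k j i p" for k i j
    unfolding christoffel_def by (simp add: gs[of _ i j] add.commute)
  have "(\<Sum>i\<in>UNIV. \<Sum>j\<in>UNIV. christoffel g k i j p * X p $ i * Y p $ j)
      = (\<Sum>i\<in>UNIV. \<Sum>j\<in>UNIV. christoffel g k i j p * Y p $ i * X p $ j)" for k
    by (subst sum.swap) (intro sum.cong refl, simp add: c mult.commute mult.left_commute)
  then show ?thesis
    by (simp add: levi_civita_def lie_bracket_def)
qed

lemma bilinear_gram:
  fixes g :: "'n::finite tensor2"
  assumes bil: "\<And>p. bilinear (g p)"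
  shows "g q u v = (\<Sum>i\<in>UNIV. \<Sum>j\<in>UNIV. gram g q $ i $ j * (u $ i * v $ j))"
proof -
  have l: "linear (\<lambda>x. g q x y)" "linear (g q x)" for x y
    using bil[of q] by (auto simp: bilinear_def)
  have "g q u v = g q (\<Sum>i\<in>UNIV. (u $ i) *\<^sub>R axis i 1) (\<Sum>j\<in>UNIV. (v $ j) *\<^sub>R axis j 1)"
    using basis_expansion[of u] basis_expansion[of v] unfolding scalar_mult_eq_scaleR by simp
  also have "\<dots> = (\<Sum>i\<in>UNIV. g q ((u $ i) *\<^sub>R axis i 1) (\<Sum>j\<in>UNIV. (v $ j) *\<^sub>R axis j 1))"
    by (rule linear_sum[OF l(1)])
  also have "\<dots> = (\<Sum>i\<in>UNIV. \<Sum>j\<in>UNIV. g q ((u $ i) *\<^sub>R axis i 1) ((v $ j) *\<^sub>R axis j 1))"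
    by (intro sum.cong refl) (rule linear_sum[OF l(2)])
  also have "\<dots> = (\<Sum>i\<in>UNIV. \<Sum>j\<in>UNIV. gram g q $ i $ j * (u $ i * v $ j))"
    by (intro sum.cong refl)
      (simp add: gram_def linear_scale[OF l(1)] linear_scale[OF l(2)] mult_ac)
  finally show ?thesis .
qed

lemma levi_civita_metric:
  fixes g :: "'n::finite tensor2"
  assumes bil: "\<And>p. bilinear (g p)" and sym: "\<And>p u v. g p u v = g p v u"
    and inv: "invertible (gram g p)"
    and dg: "\<And>i j. (\<lambda>q. gram g q $ i $ j) differentiable at p"
    and dY: "Y differentiable at p" and dZ: "Z differentiable at p"
  shows "dir_deriv X (\<lambda>q. g q (Y q) (Z q)) p
           = g p (levi_civita g X Y p) (Z p) + g p (Y p) (levi_civita g X Z p)"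
proof -
  define G where "G = gram g"
  have gsum: "g q u v = (\<Sum>i\<in>UNIV. \<Sum>j\<in>UNIV. G q $ i $ j * (u $ i * v $ j))" for q u v
    unfolding G_def by (rule bilinear_gram[OF bil])
  define dG where "dG i j = frechet_derivative (\<lambda>q. G q $ i $ j) (at p)" for i j
  define DY where "DY = frechet_derivative Y (at p)"
  define DZ where "DZ = frechet_derivative Z (at p)"
  have hG: "((\<lambda>q. G q $ i $ j) has_derivative dG i j) (at p)" for i j
    unfolding dG_def using dg[folded G_def] frechet_derivative_works by blast
  have hY: "(Y has_derivative DY) (at p)" and hZ: "(Z has_derivative DZ) (at p)"
    unfolding DY_def DZ_def using dY dZ frechet_derivative_works by blast+
  have hYi: "((\<lambda>q. Y q $ i) has_derivative (\<lambda>h. DY h $ i)) (at p)" for i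
    by (rule bounded_linear.has_derivative[OF bounded_linear_vec_nth hY])
  have hZi: "((\<lambda>q. Z q $ i) has_derivative (\<lambda>h. DZ h $ i)) (at p)" for i
    by (rule bounded_linear.has_derivative[OF bounded_linear_vec_nth hZ])
  have "((\<lambda>q. g q (Y q) (Z q)) has_derivative
     (\<lambda>h. \<Sum>i\<in>UNIV. \<Sum>j\<in>UNIV. G p $ i $ j * (Y p $ i * DZ h $ j + DY h $ i * Z p $ j)
        + dG i j h * (Y p $ i * Z p $ j))) (at p)"
    unfolding gsum
    by (rule has_derivative_sum, rule has_derivative_sum,
        rule has_derivative_mult[OF hG has_derivative_mult[OF hYi hZi]])
  from fun_cong[OF frechet_derivative_at[OF this], symmetric, of "X p"] have fd: "dir_deriv X (\<lambda>q. g q (Y q) (Z q)) p =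
     (\<Sum>i\<in>UNIV. \<Sum>j\<in>UNIV. G p $ i $ j * (Y p $ i * DZ (X p) $ j + DY (X p) $ i * Z p $ j)
        + dG i j (X p) * (Y p $ i * Z p $ j))"
    unfolding dir_deriv_def .
  define P where "P k i j = partial k (\<lambda>q. G q $ i $ j) p" for k i j
  have Psym: "P k i j = P k j i" for k i j
    unfolding P_def G_def gram_def by (simp add: sym)
  have dGX: "dG i j x = (\<Sum>k\<in>UNIV. P k i j * x $ k)" for i j x
  proof -
    have lin: "linear (dG i j)" using hG has_derivative_linear by blast
    have "dG i j x = dG i j (\<Sum>k\<in>UNIV. (x $ k) *\<^sub>R axis k 1)"
      using basis_expansion[of x] by (simp add: scalar_mult_eq_scaleR)
    also have "\<dots> = (\<Sum>k\<in>UNIV. x $ k * dG i j (axis k 1))"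
      by (simp add: linear_sum[OF lin] linear_scale[OF lin])
    finally show ?thesis by (simp add: P_def dir_deriv_def dG_def mult.commute)
  qed
  have inv': "(\<Sum>k\<in>UNIV. G p $ m $ k * matrix_inv (G p) $ k $ l) = (if m = l then 1 else 0)" for m l
  proof -
    have "G p ** matrix_inv (G p) = mat 1"
      using someI_ex[OF inv[folded G_def, unfolded invertible_def]] by (simp add: matrix_inv_def)
    then have "(G p ** matrix_inv (G p)) $ m $ l = mat 1 $ m $ l" by simp
    then show ?thesis by (simp add: matrix_matrix_mult_def mat_def)
  qed
  have low: "(\<Sum>k\<in>UNIV. G p $ m $ k * christoffel g k i j p) = (P i j m + P j i m - P m i j) / 2" for m i j
  proof -
    have "(\<Sum>k\<in>UNIV. G p $ m $ k * christoffel g k i j p)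
       = (\<Sum>k\<in>UNIV. \<Sum>l\<in>UNIV. (G p $ m $ k * matrix_inv (G p) $ k $ l) * ((P i j l + P j i l - P l i j) / 2))"
      unfolding christoffel_def G_def[symmetric] P_def[symmetric]
      by (simp add: sum_distrib_left sum_divide_distrib mult.assoc)
    also have "\<dots> = (\<Sum>l\<in>UNIV. (\<Sum>k\<in>UNIV. G p $ m $ k * matrix_inv (G p) $ k $ l) * ((P i j l + P j i l - P l i j) / 2))"
      by (subst sum.swap) (simp only: sum_distrib_right)
    also have "\<dots> = (P i j m + P j i m - P m i j) / 2"
    proof -
      have "(if m = l then 1 else 0) * x = (if m = l then x else 0)" for l and x :: real by simp
      then show ?thesis
        by (simp only: inv' sum.delta sum.delta' finite UNIV_I if_True)
    qed
    finally show ?thesis .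
  qed
  define B where "B W = (\<chi> k. \<Sum>i\<in>UNIV. \<Sum>j\<in>UNIV. christoffel g k i j p * X p $ i * W $ j)" for W
  have gB: "g p U (B W) = (\<Sum>m\<in>UNIV. \<Sum>j\<in>UNIV. \<Sum>i\<in>UNIV. (P i j m + P j i m - P m i j) / 2 * (X p $ i * W $ j * U $ m))" for U W
  proof -
    have "g p U (B W) = (\<Sum>m\<in>UNIV. \<Sum>k\<in>UNIV. \<Sum>i\<in>UNIV. \<Sum>j\<in>UNIV.
       G p $ m $ k * christoffel g k i j p * (X p $ i * W $ j * U $ m))"
      unfolding gsum B_def vec_lambda_beta sum_distrib_left
      by (intro sum.cong refl) (simp only: mult_ac)
    also have "\<dots> = (\<Sum>m\<in>UNIV. \<Sum>j\<in>UNIV. \<Sum>i\<in>UNIV. \<Sum>k\<in>UNIV.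
       G p $ m $ k * christoffel g k i j p * (X p $ i * W $ j * U $ m))"
    proof (rule sum.cong[OF refl])
      fix m
      let ?F = "\<lambda>k i j. G p $ m $ k * christoffel g k i j p * (X p $ i * W $ j * U $ m)"
      have "(\<Sum>k\<in>UNIV. \<Sum>i\<in>UNIV. \<Sum>j\<in>UNIV. ?F k i j) = (\<Sum>k\<in>UNIV. \<Sum>j\<in>UNIV. \<Sum>i\<in>UNIV. ?F k i j)"
        by (intro sum.cong[OF refl] sum.swap)
      also have "\<dots> = (\<Sum>j\<in>UNIV. \<Sum>k\<in>UNIV. \<Sum>i\<in>UNIV. ?F k i j)" by (rule sum.swap)
      also have "\<dots> = (\<Sum>j\<in>UNIV. \<Sum>i\<in>UNIV. \<Sum>k\<in>UNIV. ?F k i j)"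
        by (intro sum.cong[OF refl] sum.swap)
      finally show "(\<Sum>k\<in>UNIV. \<Sum>i\<in>UNIV. \<Sum>j\<in>UNIV. ?F k i j) = (\<Sum>j\<in>UNIV. \<Sum>i\<in>UNIV. \<Sum>k\<in>UNIV. ?F k i j)" .
    qed
    also have "\<dots> = (\<Sum>m\<in>UNIV. \<Sum>j\<in>UNIV. \<Sum>i\<in>UNIV. (\<Sum>k\<in>UNIV. G p $ m $ k * christoffel g k i j p) * (X p $ i * W $ j * U $ m))"
      by (simp add: sum_distrib_right)
    finally show ?thesis unfolding low .
  qed
  have gBB: "g p (B (Y p)) (Z p) + g p (Y p) (B (Z p)) = (\<Sum>i\<in>UNIV. \<Sum>j\<in>UNIV. dG i j (X p) * (Y p $ i * Z p $ j))"
  proof -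
    have "g p (B (Y p)) (Z p) = (\<Sum>j\<in>UNIV. \<Sum>m\<in>UNIV. \<Sum>i\<in>UNIV. (P i j m + P j i m - P m i j) / 2 * (X p $ i * Y p $ j * Z p $ m))"
      unfolding sym[of p "B (Y p)"] gB by (rule sum.swap)
    moreover have "g p (Y p) (B (Z p)) = (\<Sum>j\<in>UNIV. \<Sum>m\<in>UNIV. \<Sum>i\<in>UNIV. (P i m j + P m i j - P j i m) / 2 * (X p $ i * Z p $ m * Y p $ j))"
      unfolding gB ..
    ultimately have "g p (B (Y p)) (Z p) + g p (Y p) (B (Z p)) = (\<Sum>j\<in>UNIV. \<Sum>m\<in>UNIV. \<Sum>i\<in>UNIV.
        (P i j m + P j i m - P m i j) / 2 * (X p $ i * Y p $ j * Z p $ m)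
        + (P i m j + P m i j - P j i m) / 2 * (X p $ i * Z p $ m * Y p $ j))"
      by (simp add: sum.distrib)
    also have "\<dots> = (\<Sum>j\<in>UNIV. \<Sum>m\<in>UNIV. \<Sum>i\<in>UNIV. P i j m * X p $ i * (Y p $ j * Z p $ m))"
    proof (intro sum.cong refl)
      fix j m i
      show "(P i j m + P j i m - P m i j) / 2 * (X p $ i * Y p $ j * Z p $ m)
        + (P i m j + P m i j - P j i m) / 2 * (X p $ i * Z p $ m * Y p $ j)
        = P i j m * X p $ i * (Y p $ j * Z p $ m)"
        unfolding Psym[of i m j] by (simp add: field_simps)
    qed
    finally show ?thesis unfolding dGX by (simp add: sum_distrib_right)
  qed
  have lcY: "levi_civita g X Y p = DY (X p) + B (Y p)" and lcZ: "levi_civita g X Z p = DZ (X p) + B (Z p)"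
    by (simp_all add: levi_civita_def B_def dir_deriv_def DY_def DZ_def)
  have "g p (levi_civita g X Y p) (Z p) + g p (Y p) (levi_civita g X Z p)
     = g p (DY (X p)) (Z p) + g p (Y p) (DZ (X p)) + (g p (B (Y p)) (Z p) + g p (Y p) (B (Z p)))"
    unfolding lcY lcZ by (simp add: bilinear_ladd[OF bil] bilinear_radd[OF bil])
  also have "\<dots> = dir_deriv X (\<lambda>q. g q (Y q) (Z q)) p"
    unfolding fd gBB unfolding gsum by (simp add: sum.distrib algebra_simps)
  finally show ?thesis ..
qed

end

theory Submission
  imports Defs
begin

text \<open>
  Write \<open>\<theta> = x dy + dz\<close> and \<open>Q = dx\<^sup>2 / \<lambda>\<^sup>2 + dy\<^sup>2\<close>, so that the metric is \<open>Q - \<theta>\<^sup>2\<close>.  The Ricci tensor is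
  \<open>\<lambda>\<^sup>2 / 2 (Q + \<theta>\<^sup>2)\<close>, hence \<open>T = \<lambda>\<^sup>2 / 4 (Q + 3 \<theta>\<^sup>2)\<close>.  For every tensor \<open>\<alpha> Q + \<gamma> \<theta>\<^sup>2\<close> with
  \<open>\<alpha>, \<gamma> \<noteq> 0\<close>, a field \<open>X\<close> preserves it iff \<open>X\<close> preserves \<open>Q\<close> and \<open>\<theta>\<close>, a condition free of \<open>\<alpha>\<close> and
  \<open>\<gamma>\<close>.  Apart from \<open>\<partial>\<^sub>z X\<^sup>1 = \<partial>\<^sub>z X\<^sup>2 = 0\<close> this is read off the equations \<open>L\<^sub>X (\<alpha> Q + \<gamma> \<theta>\<^sup>2) = 0\<close> in a
  left-invariant frame, and these two equations follow by commuting the frame derivatives of \<open>\<theta>(X)\<close>,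
  which requires the symmetry of second derivatives.
\<close>

section \<open>Smooth functions and their closure properties\<close>

lemma Ck_Suc_imp: "Ck (Suc k) f \<Longrightarrow> Ck k f"
proof (induction k arbitrary: f)
  case 0
  then show ?case
    by (auto simp: continuous_on_eq_continuous_at intro: differentiable_imp_continuous_within)
next
  case (Suc k)
  from Suc.prems have "\<And>p. f differentiable at p" "\<And>v. Ck (Suc k) (\<lambda>p. frechet_derivative f (at p) v)"
    by simp_all
  then show ?case using Suc.IH by simp
qed

lemma Ck_const: "Ck k (\<lambda>_. c)"
  by (induction k arbitrary: c) (auto simp: frechet_derivative_const)

lemma Ck_add: "Ck k f \<Longrightarrow> Ck k g \<Longrightarrow> Ck k (\<lambda>p. f p + g p)"
proof (induction k arbitrary: f g)
  case (Suc k)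
  have df: "f differentiable at p" and dg: "g differentiable at p" for p
    using Suc.prems by simp_all
  have "(\<lambda>p. frechet_derivative (\<lambda>p. f p + g p) (at p) v) =
      (\<lambda>p. frechet_derivative f (at p) v + frechet_derivative g (at p) v)" for v
    by (simp add: frechet_derivative_at[symmetric, OF has_derivative_add, OF
          df[unfolded frechet_derivative_works] dg[unfolded frechet_derivative_works]])
  then show ?case
    using Suc.prems by (auto intro!: Suc.IH differentiable_add)
qed (simp add: continuous_on_add)

lemma Ck_mult:
  fixes f g :: "'a::real_normed_vector \<Rightarrow> real"
  shows "Ck k f \<Longrightarrow> Ck k g \<Longrightarrow> Ck k (\<lambda>p. f p * g p)"
proof (induction k arbitrary: f g)
  case (Suc k)
  have df: "f differentiable at p" and dg: "g differentiable at p" for p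
    using Suc.prems by simp_all
  have "(\<lambda>p. frechet_derivative (\<lambda>p. f p * g p) (at p) v) =
      (\<lambda>p. f p * frechet_derivative g (at p) v + frechet_derivative f (at p) v * g p)" for v
    by (simp add: frechet_derivative_at[symmetric, OF has_derivative_mult, OF
          df[unfolded frechet_derivative_works] dg[unfolded frechet_derivative_works]])
  \<comment> \<open>The product rule keeps one factor undifferentiated; that factor has order
    \<open>Suc k\<close> and is lowered to order \<open>k\<close> before the induction hypothesis
    applies.\<close>
  then show ?case
    using Suc.prems Ck_Suc_imp[OF Suc.prems(1)] Ck_Suc_imp[OF Suc.prems(2)]
    by (auto intro!: Ck_add Suc.IH differentiable_mult)
qed (simp add: continuous_on_mult)

lemma frechet_derivative_bounded_linear_comp:
  assumes "bounded_linear h" "f differentiable at p"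
  shows "frechet_derivative (\<lambda>p. h (f p)) (at p) = (\<lambda>v. h (frechet_derivative f (at p) v))"
  using bounded_linear.has_derivative[OF assms(1)] assms(2)
  by (metis frechet_derivative_at frechet_derivative_works)

lemma Ck_bounded_linear_comp:
  assumes h: "bounded_linear h"
  shows "Ck k f \<Longrightarrow> Ck k (\<lambda>p. h (f p))"
proof (induction k arbitrary: f)
  case 0
  then show ?case
    by (simp add: bounded_linear.continuous_on[OF h])
next
  case (Suc k)
  have "(\<lambda>p. h (f p)) differentiable at p" for p
    using Suc.prems bounded_linear.has_derivative[OF h] unfolding Ck.simps differentiable_def by metis
  then show ?case
    using Suc by (simp add: frechet_derivative_bounded_linear_comp[OF h])
qed

lemma Ck_id: "Ck k (\<lambda>p. p)"
  by (cases k) (auto simp: frechet_derivative_ident Ck_const)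

lemma smooth_const: "smooth (\<lambda>_. c)"
  by (simp add: smooth_def Ck_const)

lemma smooth_add: "smooth f \<Longrightarrow> smooth g \<Longrightarrow> smooth (\<lambda>p. f p + g p)"
  by (simp add: smooth_def Ck_add)

lemma smooth_mult:
  fixes f g :: "'a::real_normed_vector \<Rightarrow> real"
  shows "smooth f \<Longrightarrow> smooth g \<Longrightarrow> smooth (\<lambda>p. f p * g p)"
  by (simp add: smooth_def Ck_mult)

lemma smooth_nth: "smooth f \<Longrightarrow> smooth (\<lambda>p. f p $ i)"
  by (simp add: smooth_def Ck_bounded_linear_comp[OF bounded_linear_vec_nth])

lemma smooth_coord: "smooth (\<lambda>p. p $ i)"
  by (rule smooth_nth) (simp add: smooth_def Ck_id)

lemma smooth_differentiable: "smooth f \<Longrightarrow> f differentiable at p"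
  by (metis Ck.simps(2) smooth_def)

lemma smooth_dir_deriv_const: "smooth f \<Longrightarrow> smooth (dir_deriv (\<lambda>_. v) f)"
  unfolding smooth_def dir_deriv_def by (metis Ck.simps(2))

lemma smooth_continuous: "smooth f \<Longrightarrow> continuous (at p) f"
  using smooth_differentiable differentiable_imp_continuous_within by blast

section \<open>Symmetry of second derivatives\<close>

lemma has_real_derivative_along:
  fixes f :: "real ^ 'n \<Rightarrow> real"
  assumes "smooth f"
  shows "((\<lambda>s. f (p + s *\<^sub>R u)) has_real_derivative dir_deriv (\<lambda>_. u) f (p + s *\<^sub>R u)) (at s)"
proof -
  have f: "(f has_derivative frechet_derivative f (at (p + s *\<^sub>R u))) (at (p + s *\<^sub>R u))"
    using smooth_differentiable[OF assms] frechet_derivative_works by blast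
  have "((\<lambda>s. f (p + s *\<^sub>R u)) has_derivative
      (\<lambda>h. frechet_derivative f (at (p + s *\<^sub>R u)) (h *\<^sub>R u))) (at s)"
    by (rule has_derivative_compose[where f="\<lambda>s. p + s *\<^sub>R u" and g=f, OF _ f]) (auto intro!: derivative_eq_intros)
  then show ?thesis
    by (rule has_derivative_imp_has_field_derivative)
      (simp add: dir_deriv_def linear_scale[OF linear_frechet_derivative[OF smooth_differentiable[OF assms]]] mult.commute)
qed

text \<open>The mean value theorem is used twice: first along \<open>u\<close> for the increment of
  \<open>f\<close> in the direction \<open>v\<close>, then along \<open>v\<close> for the
  \<open>u\<close>-derivative of \<open>f\<close>.\<close>

lemma second_difference_mean_value:
  fixes f :: "real ^ 'n \<Rightarrow> real"
  assumes f: "smooth f" and t: "t > 0"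
  obtains r s where "0 < r" "r < t" "0 < s" "s < t"
    "f (p + t *\<^sub>R u + t *\<^sub>R v) - f (p + t *\<^sub>R u) - f (p + t *\<^sub>R v) + f p
      = t\<^sup>2 * dir_deriv (\<lambda>_. v) (dir_deriv (\<lambda>_. u) f) (p + r *\<^sub>R u + s *\<^sub>R v)"
proof -
  let ?\<phi> = "\<lambda>s. f ((p + t *\<^sub>R v) + s *\<^sub>R u) - f (p + s *\<^sub>R u)"
  have "(?\<phi> has_real_derivative dir_deriv (\<lambda>_. u) f ((p + t *\<^sub>R v) + s *\<^sub>R u)
      - dir_deriv (\<lambda>_. u) f (p + s *\<^sub>R u)) (at s)" for s
    by (intro DERIV_diff has_real_derivative_along f)
  from MVT2[OF t this] obtain r where r: "0 < r" "r < t" and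
    1: "?\<phi> t - ?\<phi> 0 = (t - 0) * (dir_deriv (\<lambda>_. u) f ((p + t *\<^sub>R v) + r *\<^sub>R u)
      - dir_deriv (\<lambda>_. u) f (p + r *\<^sub>R u))" by blast
  let ?\<psi> = "\<lambda>s. dir_deriv (\<lambda>_. u) f ((p + r *\<^sub>R u) + s *\<^sub>R v)"
  have "(?\<psi> has_real_derivative
      dir_deriv (\<lambda>_. v) (dir_deriv (\<lambda>_. u) f) ((p + r *\<^sub>R u) + s *\<^sub>R v)) (at s)" for s
    by (intro has_real_derivative_along smooth_dir_deriv_const f)
  from MVT2[OF t this] obtain s where s: "0 < s" "s < t" and
    2: "?\<psi> t - ?\<psi> 0 = (t - 0) * dir_deriv (\<lambda>_. v) (dir_deriv (\<lambda>_. u) f) ((p + r *\<^sub>R u) + s *\<^sub>R v)"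
    by blast
  show thesis
    by (rule that[OF r s]) (use 1 2 in \<open>simp add: algebra_simps power2_eq_square\<close>)
qed

text \<open>The second difference is symmetric in \<open>u\<close> and \<open>v\<close>, and divided
  by \<open>t\<^sup>2\<close> it is a value of either mixed derivative at a point near
  \<open>p\<close>. Continuity of both derivatives then forces agreement at
  \<open>p\<close>.\<close>

lemma dir_deriv_commute:
  fixes f :: "real ^ 'n \<Rightarrow> real"
  assumes f: "smooth f"
  shows "dir_deriv (\<lambda>_. v) (dir_deriv (\<lambda>_. u) f) p = dir_deriv (\<lambda>_. u) (dir_deriv (\<lambda>_. v) f) p"
    (is "?A p = ?B p")
proof (rule ccontr)
  assume ne: "?A p \<noteq> ?B p"
  \<comment> \<open>Half the gap: two numbers \<open>2 * e\<close> apart cannot be brought together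
    by moving each less than \<open>e\<close>.\<close>
  define e where "e = \<bar>?A p - ?B p\<bar> / 2"
  have e: "e > 0" using ne by (simp add: e_def)
  have "continuous (at p) ?A" "continuous (at p) ?B"
    by (intro smooth_continuous smooth_dir_deriv_const f)+
  then have "\<exists>d>0. \<forall>q. dist q p < d \<longrightarrow> dist (?A q) (?A p) < e"
    "\<exists>d>0. \<forall>q. dist q p < d \<longrightarrow> dist (?B q) (?B p) < e"
    using e unfolding continuous_at_eps_delta by (simp_all only:)
  then obtain d1 d2 where d: "d1 > 0" "d2 > 0"
    and A: "\<And>q. dist q p < d1 \<Longrightarrow> \<bar>?A q - ?A p\<bar> < e"
    and B: "\<And>q. dist q p < d2 \<Longrightarrow> \<bar>?B q - ?B p\<bar> < e"
    unfolding dist_real_def by (elim exE conjE) blast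
  \<comment> \<open>Steps shorter than \<open>t\<close> along \<open>u\<close> and \<open>v\<close>
    stay within \<open>min d1 d2\<close> of \<open>p\<close>; the summand 1 keeps the denominator
    positive when \<open>u\<close> and \<open>v\<close> are zero.\<close>
  define t where "t = min d1 d2 / (norm u + norm v + 1)"
  have n: "norm u + norm v + 1 > 0" by (simp add: add_nonneg_pos)
  have t: "t > 0" using d n by (simp add: t_def)
  have near: "dist (p + r *\<^sub>R u + s *\<^sub>R v) p < min d1 d2" if "0 < r" "r < t" "0 < s" "s < t" for r s
  proof -
    have "dist (p + r *\<^sub>R u + s *\<^sub>R v) p \<le> r * norm u + s * norm v"
      using norm_triangle_ineq[of "r *\<^sub>R u" "s *\<^sub>R v"] that by (simp add: dist_norm algebra_simps)
    also have "\<dots> \<le> t * norm u + t * norm v"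
      using that by (intro add_mono mult_right_mono) auto
    also have "\<dots> < t * (norm u + norm v + 1)"
      using t by (simp add: algebra_simps)
    also have "\<dots> = min d1 d2" using n by (simp add: t_def)
    finally show ?thesis .
  qed
  obtain r s where rs: "0 < r" "r < t" "0 < s" "s < t"
    "f (p + t *\<^sub>R u + t *\<^sub>R v) - f (p + t *\<^sub>R u) - f (p + t *\<^sub>R v) + f p
      = t\<^sup>2 * ?A (p + r *\<^sub>R u + s *\<^sub>R v)"
    using second_difference_mean_value[OF f t] by blast
  \<comment> \<open>The same second difference with \<open>u\<close> and \<open>v\<close> exchanged,
    so that the other mixed derivative appears.\<close>
  obtain r' s' where rs': "0 < r'" "r' < t" "0 < s'" "s' < t"
    "f (p + t *\<^sub>R v + t *\<^sub>R u) - f (p + t *\<^sub>R v) - f (p + t *\<^sub>R u) + f p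
      = t\<^sup>2 * ?B (p + r' *\<^sub>R v + s' *\<^sub>R u)"
    using second_difference_mean_value[OF f t] by blast
  have "t\<^sup>2 * ?A (p + r *\<^sub>R u + s *\<^sub>R v) = t\<^sup>2 * ?B (p + s' *\<^sub>R u + r' *\<^sub>R v)"
    using rs(5) rs'(5) by (simp add: algebra_simps)
  then have "?A (p + r *\<^sub>R u + s *\<^sub>R v) = ?B (p + s' *\<^sub>R u + r' *\<^sub>R v)"
    using t by simp
  moreover have "\<bar>?A (p + r *\<^sub>R u + s *\<^sub>R v) - ?A p\<bar> < e"
    using A near[OF rs(1-4)] by simp
  moreover have "\<bar>?B (p + s' *\<^sub>R u + r' *\<^sub>R v) - ?B p\<bar> < e"
    using B near[OF rs'(3,4,1,2)] by simp
  ultimately show False by (simp add: e_def abs_if split: if_splits)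
qed

section \<open>Orthonormal bases and metric traces\<close>

text \<open>Pairing with \<open>e j\<close> recovers each coefficient up to the sign
  \<open>b (e j) (e j)\<close>, so the map \<open>L\<close> from coefficients to vectors is
  injective, hence surjective by dimension. Each sign is its own inverse, which accounts for the
  factor \<open>b (e k) (e k)\<close>.\<close>

lemma orthonormal_basis_expansion:
  fixes b :: "real ^ 'n \<Rightarrow> real ^ 'n \<Rightarrow> real" and e :: "'n \<Rightarrow> real ^ 'n"
  assumes b: "bilinear b" and e: "orthonormal_basis b e"
  shows "v = (\<Sum>k\<in>UNIV. (b (e k) (e k) * b v (e k)) *\<^sub>R e k)"
proof -
  have b1: "linear (\<lambda>x. b x y)" for y using b by (simp add: bilinear_def)
  have on: "b (e i) (e j) = (if i = j then b (e i) (e i) else 0)" for i j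
    using e by (auto simp: orthonormal_basis_def)
  have sq: "b (e i) (e i) * b (e i) (e i) = 1" for i
    using e unfolding orthonormal_basis_def by (metis mult_1 mult_minus1 minus_minus)
  have coeff: "b (\<Sum>k\<in>UNIV. c k *\<^sub>R e k) (e j) = c j * b (e j) (e j)" for c j
  proof -
    have "b (\<Sum>k\<in>UNIV. c k *\<^sub>R e k) (e j) = (\<Sum>k\<in>UNIV. c k * b (e k) (e j))"
      by (simp add: linear_sum[OF b1] linear_scale[OF b1])
    also have "\<dots> = (\<Sum>k\<in>UNIV. if k = j then c k * b (e k) (e k) else 0)"
      by (intro sum.cong refl) (subst on, simp)
    also have "\<dots> = c j * b (e j) (e j)" by (simp only: sum.delta finite UNIV_I if_True)
    finally show ?thesis .
  qed
  define L where "L x = (\<Sum>k\<in>UNIV. (x $ k) *\<^sub>R e k)" for x :: "real ^ 'n"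
  have L: "linear L"
    by (rule linearI) (simp_all add: L_def scaleR_add_left sum.distrib scaleR_sum_right)
  have "inj L"
  proof (rule linear_injective_0[OF L, THEN iffD2], intro allI impI)
    fix x assume "L x = 0"
    then have "x $ j * b (e j) (e j) = 0" for j
      using coeff[of "\<lambda>k. x $ k" j] linear_0[OF b1] by (simp add: L_def)
    then show "x = 0" using sq by (simp add: vec_eq_iff) (metis mult_zero_left zero_neq_one)
  qed
  then have "surj L" using L linear_injective_imp_surjective by blast
  then obtain x where "v = L x" by (metis surjD)
  moreover have "b (e k) (e k) * b (L x) (e k) = x $ k" for k
    using coeff[of "\<lambda>k. x $ k" k] sq[of k] by (simp add: L_def mult.left_commute)
  ultimately show ?thesis by (simp add: L_def)
qed

text \<open>Expand \<open>e k\<close> in the basis \<open>e'\<close>, exchange the sums, and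
  recognise the inner sum as the expansion of \<open>e' l\<close> in \<open>e\<close>. This frees
  the curvature traces from the basis picked by \<open>some_onb\<close>.\<close>

lemma orthonormal_basis_trace:
  fixes b B :: "real ^ 'n \<Rightarrow> real ^ 'n \<Rightarrow> real" and e e' :: "'n \<Rightarrow> real ^ 'n"
  assumes b: "bilinear b" and sym: "\<And>u v. b u v = b v u" and B: "bilinear B"
    and e: "orthonormal_basis b e" and e': "orthonormal_basis b e'"
  shows "(\<Sum>k\<in>UNIV. b (e k) (e k) * B (e k) (e k)) = (\<Sum>k\<in>UNIV. b (e' k) (e' k) * B (e' k) (e' k))"
proof -
  have B1: "linear (\<lambda>x. B x y)" and B2: "linear (B x)" for x y using B by (simp_all add: bilinear_def)
  have b1: "linear (\<lambda>x. b x y)" for y using b by (simp add: bilinear_def)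
  have "B (e k) (e k) = (\<Sum>l\<in>UNIV. b (e' l) (e' l) * b (e k) (e' l) * B (e' l) (e k))" for k
  proof -
    have "B (e k) (e k) = B (\<Sum>l\<in>UNIV. (b (e' l) (e' l) * b (e k) (e' l)) *\<^sub>R e' l) (e k)"
      using orthonormal_basis_expansion[OF b e', of "e k"] by simp
    then show ?thesis by (simp add: linear_sum[OF B1] linear_scale[OF B1])
  qed
  then have "(\<Sum>k\<in>UNIV. b (e k) (e k) * B (e k) (e k))
      = (\<Sum>k\<in>UNIV. \<Sum>l\<in>UNIV. b (e k) (e k) * (b (e' l) (e' l) * b (e k) (e' l) * B (e' l) (e k)))"
    by (simp add: sum_distrib_left)
  also have "\<dots> = (\<Sum>l\<in>UNIV. \<Sum>k\<in>UNIV. b (e k) (e k) * (b (e' l) (e' l) * b (e k) (e' l) * B (e' l) (e k)))"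
    by (rule sum.swap)
  also have "\<dots> = (\<Sum>l\<in>UNIV. b (e' l) (e' l) * B (e' l) (e' l))"
  proof (rule sum.cong[OF refl])
    fix l
    have "B (e' l) (e' l) = B (e' l) (\<Sum>k\<in>UNIV. (b (e k) (e k) * b (e' l) (e k)) *\<^sub>R e k)"
      using orthonormal_basis_expansion[OF b e, of "e' l"] by simp
    then have "B (e' l) (e' l) = (\<Sum>k\<in>UNIV. b (e k) (e k) * b (e' l) (e k) * B (e' l) (e k))"
      by (simp add: linear_sum[OF B2] linear_scale[OF B2])
    then show "(\<Sum>k\<in>UNIV. b (e k) (e k) * (b (e' l) (e' l) * b (e k) (e' l) * B (e' l) (e k)))
        = b (e' l) (e' l) * B (e' l) (e' l)"
      by (simp add: sum_distrib_left sym[of "e _" "e' l"] mult_ac)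
  qed
  finally show ?thesis .
qed

section \<open>Directional derivatives and the left-invariant frame\<close>

lemma dir_deriv_lincomb:
  fixes f g :: "real ^ 'n \<Rightarrow> real"
  assumes "smooth f" "smooth g"
  shows "dir_deriv X (\<lambda>q. r * f q + s * g q) p = r * dir_deriv X f p + s * dir_deriv X g p"
proof -
  have "((\<lambda>q. r * f q + s * g q) has_derivative
      (\<lambda>h. r * frechet_derivative f (at p) h + s * frechet_derivative g (at p) h)) (at p)"
    using assms[THEN smooth_differentiable, unfolded frechet_derivative_works]
    by (intro has_derivative_add has_derivative_mult_right)
  from frechet_derivative_at[OF this, symmetric] show ?thesis by (simp add: dir_deriv_def)
qed

lemma dir_deriv_mult:
  fixes f g :: "real ^ 'n \<Rightarrow> real"
  assumes "smooth f" "smooth g"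
  shows "dir_deriv X (\<lambda>q. f q * g q) p = f p * dir_deriv X g p + dir_deriv X f p * g p"
  unfolding dir_deriv_def
  by (simp add: frechet_derivative_at[symmetric, OF has_derivative_mult, OF
        assms[THEN smooth_differentiable, unfolded frechet_derivative_works]])

lemma dir_deriv_zero: "dir_deriv X (\<lambda>_. 0) p = 0"
  by (simp add: dir_deriv_def frechet_derivative_const)

lemma dir_deriv_nth:
  assumes "Y differentiable at p"
  shows "dir_deriv X (\<lambda>q. Y q $ i) p = dir_deriv X Y p $ i"
  by (simp add: dir_deriv_def frechet_derivative_bounded_linear_comp[OF bounded_linear_vec_nth assms])

lemma dir_deriv_coord: "dir_deriv X (\<lambda>q. q $ i) p = X p $ i"
  by (simp add: dir_deriv_def
      frechet_derivative_bounded_linear_comp[OF bounded_linear_vec_nth, of "\<lambda>q. q"]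
      frechet_derivative_ident)

text \<open>With \<open>E\<^sub>1 = \<partial>\<^sub>x\<close> and \<open>E\<^sub>3 = \<partial>\<^sub>z\<close> this completes a left-invariant frame; \<open>[E\<^sub>1, E\<^sub>2] = - E\<^sub>3\<close> is its only
  nonzero bracket.\<close>
definition heis_E2 :: "3 vfield" where
  "heis_E2 q = axis 2 1 - q $ 1 *\<^sub>R axis 3 1"

lemma dir_deriv_heis_E2:
  fixes f :: "real ^ 3 \<Rightarrow> real"
  assumes "smooth f"
  shows "dir_deriv heis_E2 f p = partial 2 f p - p $ 1 * partial 3 f p"
proof -
  have "linear (frechet_derivative f (at p))"
    using assms smooth_differentiable linear_frechet_derivative by blast
  then show ?thesis
    by (simp add: dir_deriv_def heis_E2_def linear_diff linear_scale)
qed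

lemma smooth_dir_deriv_heis_E2:
  fixes f :: "real ^ 3 \<Rightarrow> real"
  assumes "smooth f"
  shows "smooth (dir_deriv heis_E2 f)"
proof -
  have "dir_deriv heis_E2 f = (\<lambda>p. partial 2 f p + (- 1 * (p $ 1)) * partial 3 f p)"
    by (rule ext) (simp add: dir_deriv_heis_E2 assms)
  then show ?thesis
    by (simp only:) (intro smooth_add smooth_mult smooth_dir_deriv_const smooth_const smooth_coord assms)
qed

text \<open>The coefficients of \<open>heis_E2\<close> depend on x alone, so only the x-derivative
  fails to commute with it, and differentiating the factor x leaves a central derivative.\<close>

lemma dir_deriv_heis_E2_partial:
  fixes f :: "real ^ 3 \<Rightarrow> real"
  assumes f: "smooth f"
  shows "partial i (dir_deriv heis_E2 f) p
    = dir_deriv heis_E2 (partial i f) p - (if i = 1 then partial 3 f p else 0)"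
proof -
  have s: "smooth (partial j f)" for j using f by (rule smooth_dir_deriv_const)
  have "dir_deriv heis_E2 f = (\<lambda>p. 1 * partial 2 f p + (- 1) * (p $ 1 * partial 3 f p))"
    by (rule ext) (simp add: dir_deriv_heis_E2 f)
  then have "partial i (dir_deriv heis_E2 f) p
      = partial i (partial 2 f) p - (p $ 1 * partial i (partial 3 f) p + axis i 1 $ 1 * partial 3 f p)"
    using dir_deriv_lincomb[OF s smooth_mult[OF smooth_coord s], of "\<lambda>_. axis i 1" 1 2 "- 1" 1 3 p]
    by (simp add: dir_deriv_mult[OF smooth_coord s] dir_deriv_coord)
  then show ?thesis
    unfolding dir_deriv_heis_E2[OF s] dir_deriv_commute[OF f, of "axis i 1"]
    by (auto simp: axis_def)
qed

section \<open>Integrability conditions of the isometry equations\<close>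

text \<open>In the application \<open>a\<close> and \<open>b\<close> are the first two components of
  the field, \<open>F\<close> is its pairing with \<theta>, \<open>l\<close> is
  \<open>lam\<^sup>2\<close> and \<open>k\<close> is
  \<open>\<alpha> / (\<gamma> * lam\<^sup>2)\<close>. Commuting E1 and E2 on \<open>F\<close> gives
  E3 E1 \<open>b\<close> = 0; differentiating \<open>F\<close> by E3 ties E3 \<open>b\<close> to E3
  E3 \<open>a\<close> and E3 \<open>a\<close> to E3 E3 \<open>b\<close>. Once E3 E3 \<open>a\<close>
  = 0, both first derivatives vanish in turn.\<close>

lemma heis_killing_system_central_derivatives:
  fixes a b F :: "real ^ 3 \<Rightarrow> real"
  assumes a: "smooth a" and b: "smooth b" and F: "smooth F" and kl: "k \<noteq> 0" "l \<noteq> 0"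
    and a1: "\<And>p. partial 1 a p = 0" and b2: "\<And>p. dir_deriv heis_E2 b p = 0"
    and F3: "\<And>p. partial 3 F p = 0"
    and a2: "\<And>p. dir_deriv heis_E2 a p = - l * partial 1 b p"
    and F1: "\<And>p. partial 1 F p = b p - k * partial 3 a p"
    and F2: "\<And>p. dir_deriv heis_E2 F p = - a p - k * l * partial 3 b p"
  shows "partial 3 a p = 0" "partial 3 b p = 0"
proof -
  have sa: "smooth (partial i a)" and sb: "smooth (partial i b)" for i
    using a b by (auto intro: smooth_dir_deriv_const)
  have F1': "partial 1 F = (\<lambda>p. 1 * b p + (- k) * partial 3 a p)" by (rule ext) (simp add: F1)
  have F2': "dir_deriv heis_E2 F = (\<lambda>p. (- 1) * a p + (- k * l) * partial 3 b p)"
    by (rule ext) (simp add: F2)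
  have z: "f = (\<lambda>_. 0)" if "\<And>p. f p = 0" for f :: "real ^ 3 \<Rightarrow> real" using that by (rule ext)
  have a13: "partial 1 (partial 3 a) p = 0" for p
    using z[OF a1] by (subst dir_deriv_commute[OF a]) (simp add: dir_deriv_zero)
  have E3a: "dir_deriv heis_E2 (partial 3 a) p = - l * partial 3 (partial 1 b) p" for p
  proof -
    \<comment> \<open>The zero summand puts the right-hand side into the two-term shape of
      \<open>dir_deriv_lincomb\<close>.\<close>
    have "dir_deriv heis_E2 a = (\<lambda>p. (- l) * partial 1 b p + 0 * b p)" by (rule ext) (simp add: a2)
    then show ?thesis
      using dir_deriv_heis_E2_partial[OF a, of 3 p] dir_deriv_lincomb[OF sb b, of _ "- l" 1 0 p] by simp
  qed
  \<comment> \<open>E1 and E2 commute on \<open>F\<close> because E3 \<open>F\<close> = 0, yet the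
    two orders of differentiation give opposite multiples of E3 E1 \<open>b\<close>.\<close>
  have b31: "partial 3 (partial 1 b) p = 0" for p
  proof -
    have "partial 1 (dir_deriv heis_E2 F) p = dir_deriv heis_E2 (partial 1 F) p"
      using dir_deriv_heis_E2_partial[OF F, of 1 p] F3 by simp
    moreover have "partial 1 (dir_deriv heis_E2 F) p = - k * l * partial 3 (partial 1 b) p"
      unfolding F2' dir_deriv_lincomb[OF a sb] by (simp add: a1 dir_deriv_commute[OF b, of "axis 1 1"])
    moreover have "dir_deriv heis_E2 (partial 1 F) p = k * l * partial 3 (partial 1 b) p"
      unfolding F1' dir_deriv_lincomb[OF b sa] by (simp add: b2 E3a)
    ultimately show ?thesis using kl by simp
  qed
  have b3: "partial 3 b p = k * partial 3 (partial 3 a) p" for p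
  proof -
    have "partial 3 (partial 1 F) p = 0"
      using z[OF F3] by (subst dir_deriv_commute[OF F]) (simp add: dir_deriv_zero)
    then show ?thesis unfolding F1' dir_deriv_lincomb[OF b sa] by simp
  qed
  have a3: "partial 3 a p = - (k * l) * partial 3 (partial 3 b) p" for p
  proof -
    have "partial 3 (dir_deriv heis_E2 F) p = 0"
      using dir_deriv_heis_E2_partial[OF F, of 3 p] z[OF F3] by (simp add: dir_deriv_zero)
    then show ?thesis unfolding F2' dir_deriv_lincomb[OF a sb] by simp
  qed
  have "partial 3 (partial 3 a) p = 0" for p
    \<comment> \<open>\<open>\<partial>\<^sub>z a\<close> is killed by \<open>E\<^sub>1\<close> and \<open>E\<^sub>2\<close>, hence by their bracket.\<close>
    using dir_deriv_heis_E2_partial[OF sa, of 1 3 p] z[OF a13] E3a b31 z[of "dir_deriv heis_E2 (partial 3 a)"]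
    by (simp add: dir_deriv_zero)
  then have b3z: "partial 3 b q = 0" for q using b3 by simp
  then show "partial 3 b p = 0" .
  show "partial 3 a p = 0" using a3[of p] z[OF b3z] by (simp add: dir_deriv_zero)
qed

section \<open>Lie derivatives of the invariant tensors\<close>

text \<open>One two-parameter family holds the metric, its Ricci tensor and its energy-momentum
  tensor, so a single Lie derivative computation serves the metric and the energy-momentum
  tensor.\<close>

definition heis_tensor :: "real \<Rightarrow> real \<Rightarrow> real \<Rightarrow> 3 tensor2" where
  "heis_tensor lam \<alpha> \<gamma> p u v = \<alpha> * (u $ 1 * v $ 1 / lam\<^sup>2 + u $ 2 * v $ 2)
     + \<gamma> * ((p $ 1 * u $ 2 + u $ 3) * (p $ 1 * v $ 2 + v $ 3))"

text \<open>This is the Leibniz rule, with \<open>\<omega>\<close> the Lie derivative of \<theta>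
  along \<open>X\<close>. The derivatives of \<open>Y\<close> and \<open>Z\<close> cancel against
  the brackets, so only their values at \<open>p\<close> remain.\<close>

lemma lie_derivative_heis_tensor:
  fixes X Y Z :: "3 vfield" and p :: "real ^ 3"
  assumes Y: "smooth Y" and Z: "smooth Z"
  defines "D \<equiv> frechet_derivative X (at p)"
  defines "\<omega> \<equiv> \<lambda>u. X p $ 1 * u $ 2 + p $ 1 * D u $ 2 + D u $ 3"
  shows "lie_derivative X (heis_tensor lam \<alpha> \<gamma>) Y Z p =
    \<alpha> * ((D (Y p) $ 1 * Z p $ 1 + Y p $ 1 * D (Z p) $ 1) / lam\<^sup>2
       + D (Y p) $ 2 * Z p $ 2 + Y p $ 2 * D (Z p) $ 2)
    + \<gamma> * (\<omega> (Y p) * (p $ 1 * Z p $ 2 + Z p $ 3) + (p $ 1 * Y p $ 2 + Y p $ 3) * \<omega> (Z p))"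
proof -
  define DY where "DY = frechet_derivative Y (at p)"
  define DZ where "DZ = frechet_derivative Z (at p)"
  have hY: "((\<lambda>q. Y q $ i) has_derivative (\<lambda>h. DY h $ i)) (at p)" for i
    using bounded_linear.has_derivative[OF bounded_linear_vec_nth]
      smooth_differentiable[OF Y] unfolding DY_def frechet_derivative_works by blast
  have hZ: "((\<lambda>q. Z q $ i) has_derivative (\<lambda>h. DZ h $ i)) (at p)" for i
    using bounded_linear.has_derivative[OF bounded_linear_vec_nth]
      smooth_differentiable[OF Z] unfolding DZ_def frechet_derivative_works by blast
  have hp: "((\<lambda>q::real^3. q $ i) has_derivative (\<lambda>h. h $ i)) (at p)" for i
    by (rule bounded_linear_imp_has_derivative[OF bounded_linear_vec_nth])
  have "((\<lambda>q. heis_tensor lam \<alpha> \<gamma> q (Y q) (Z q)) has_derivative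
     (\<lambda>h. \<alpha> * ((Y p $ 1 * DZ h $ 1 + DY h $ 1 * Z p $ 1) / lam\<^sup>2 + (Y p $ 2 * DZ h $ 2 + DY h $ 2 * Z p $ 2))
     + \<gamma> * ((p $ 1 * Y p $ 2 + Y p $ 3) * ((p $ 1 * DZ h $ 2 + h $ 1 * Z p $ 2) + DZ h $ 3)
       + ((p $ 1 * DY h $ 2 + h $ 1 * Y p $ 2) + DY h $ 3) * (p $ 1 * Z p $ 2 + Z p $ 3)))) (at p)"
    unfolding heis_tensor_def divide_inverse
    by (intro has_derivative_add has_derivative_mult has_derivative_mult_left has_derivative_mult_right hY hZ hp)
  from fun_cong[OF frechet_derivative_at[OF this], symmetric, of "X p"]
  show ?thesis
    unfolding lie_derivative_def lie_bracket_def dir_deriv_def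
    unfolding D_def[symmetric] DY_def[symmetric] DZ_def[symmetric] \<omega>_def
    by (simp add: heis_tensor_def algebra_simps add_divide_distrib diff_divide_distrib)
qed

text \<open>In coordinates: \<open>L\<^sub>X (dx\<^sup>2 / \<lambda>\<^sup>2 + dy\<^sup>2) = 0\<close> and \<open>L\<^sub>X (x dy + dz) = 0\<close>.\<close>
definition heis_isometry_field :: "real \<Rightarrow> 3 vfield \<Rightarrow> bool" where
  "heis_isometry_field lam X \<longleftrightarrow> (\<forall>p.
     partial 1 X p $ 1 = 0 \<and> partial 2 X p $ 1 = - lam\<^sup>2 * partial 1 X p $ 2 \<and> partial 3 X p $ 1 = 0 \<and>
     partial 2 X p $ 2 = 0 \<and> partial 3 X p $ 2 = 0 \<and>
     partial 1 X p $ 3 = - p $ 1 * partial 1 X p $ 2 \<and> partial 2 X p $ 3 = - X p $ 1 \<and> partial 3 X p $ 3 = 0)"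

text \<open>The xy-block of the derivative of \<open>X\<close> is skew for Q and the Lie derivative
  of \<theta> vanishes, so the two summands are zero separately, whatever the coefficients.\<close>

lemma heis_isometry_field_imp_lie_derivative:
  fixes X Y Z :: "3 vfield"
  assumes lam: "lam \<noteq> 0" and X: "smooth X" and Y: "smooth Y" and Z: "smooth Z"
    and K: "heis_isometry_field lam X"
  shows "lie_derivative X (heis_tensor lam \<alpha> \<gamma>) Y Z p = 0"
proof -
  define D where "D = frechet_derivative X (at p)"
  have lin: "linear D"
    using X smooth_differentiable linear_frechet_derivative unfolding D_def by blast
  have D: "D u $ j = u $ 1 * partial 1 X p $ j + u $ 2 * partial 2 X p $ j + u $ 3 * partial 3 X p $ j"
    for u j
  proof -
    have "D u = D (\<Sum>i\<in>UNIV. u $ i *\<^sub>R axis i 1)"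
      using basis_expansion[of u] by (simp add: scalar_mult_eq_scaleR)
    then show ?thesis
      by (simp add: sum_3 linear_add[OF lin] linear_scale[OF lin] dir_deriv_def D_def[symmetric])
  qed
  have "partial 1 X p $ 1 = 0" "partial 2 X p $ 1 = - lam\<^sup>2 * partial 1 X p $ 2" "partial 3 X p $ 1 = 0"
     "partial 2 X p $ 2 = 0" "partial 3 X p $ 2 = 0"
     "partial 1 X p $ 3 = - p $ 1 * partial 1 X p $ 2" "partial 2 X p $ 3 = - X p $ 1" "partial 3 X p $ 3 = 0"
    using K unfolding heis_isometry_field_def by blast+
  note c = this
  show ?thesis
    unfolding lie_derivative_heis_tensor[OF Y Z] D_def[symmetric] D c
    using lam by (simp add: field_simps)
qed

text \<open>The six symmetric pairs of frame vectors give six equations: the diagonal pairs yield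
  \<open>1\<close>, \<open>2\<close>, \<open>3\<close>, the mixed ones \<open>4\<close>,
  \<open>5\<close>, \<open>6\<close>. These form the system whose central derivatives were shown to
  vanish.\<close>

lemma lie_derivative_imp_heis_isometry_field:
  fixes X :: "3 vfield"
  assumes lam: "lam \<noteq> 0" and al: "\<alpha> \<noteq> 0" and ga: "\<gamma> \<noteq> 0" and X: "smooth X"
    and L: "\<And>Y Z p. smooth Y \<Longrightarrow> smooth Z \<Longrightarrow> lie_derivative X (heis_tensor lam \<alpha> \<gamma>) Y Z p = 0"
  shows "heis_isometry_field lam X"
proof -
  define a where "a = (\<lambda>q. X q $ 1)"
  define b where "b = (\<lambda>q. X q $ 2)"
  define c where "c = (\<lambda>q. X q $ 3)"
  define F where "F = (\<lambda>q::real^3. q $ 1 * b q + c q)"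
  have s: "smooth a" "smooth b" "smooth c"
    unfolding a_def b_def c_def using X by (auto intro: smooth_nth)
  have sF: "smooth F" unfolding F_def by (intro smooth_add smooth_mult smooth_coord s)
  have nth: "dir_deriv Y X p $ 1 = dir_deriv Y a p" "dir_deriv Y X p $ 2 = dir_deriv Y b p"
    "dir_deriv Y X p $ 3 = dir_deriv Y c p" for Y p
    by (simp_all add: a_def b_def c_def dir_deriv_nth[OF smooth_differentiable[OF X]])
  have DF: "dir_deriv Y F p = Y p $ 1 * b p + p $ 1 * dir_deriv Y b p + dir_deriv Y c p" for Y p
  proof -
    have "F = (\<lambda>q. 1 * (q $ 1 * b q) + 1 * c q)" by (simp add: F_def)
    then show ?thesis
      using dir_deriv_lincomb[OF smooth_mult[OF smooth_coord s(2)] s(3), of Y 1 1 1 p]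
      by (simp add: dir_deriv_mult[OF smooth_coord s(2)] dir_deriv_coord)
  qed
  define e where "e i = (if i = 1 then (\<lambda>_. axis 1 1) else if i = 2 then heis_E2 else (\<lambda>_. axis 3 1))" for i :: 3
  have fd: "frechet_derivative X (at p) (e i p) = dir_deriv (e i) X p" for i p
    by (simp add: dir_deriv_def)
  \<comment> \<open>The frame vectors at \<open>p\<close> are extended as constant fields; this
    suffices because the Lie derivative depends only on their values at \<open>p\<close>.\<close>
  have E: "\<alpha> * ((dir_deriv (e i) a p * e j p $ 1 + e i p $ 1 * dir_deriv (e j) a p) / lam\<^sup>2
       + dir_deriv (e i) b p * e j p $ 2 + e i p $ 2 * dir_deriv (e j) b p)
    + \<gamma> * ((a p * e i p $ 2 + p $ 1 * dir_deriv (e i) b p + dir_deriv (e i) c p) * (p $ 1 * e j p $ 2 + e j p $ 3)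
      + (p $ 1 * e i p $ 2 + e i p $ 3) * (a p * e j p $ 2 + p $ 1 * dir_deriv (e j) b p + dir_deriv (e j) c p)) = 0"
    for i j p
    using L[OF smooth_const smooth_const, of "e i p" "e j p" p]
    unfolding lie_derivative_heis_tensor[OF smooth_const smooth_const] fd nth
    by (simp add: a_def)
  have ax: "axis i (1::real) $ j = (if i = j then 1 else 0)" for i j :: 3
    by (simp add: axis_def)
  have e: "e 1 = (\<lambda>_. axis 1 1)" "e 2 = heis_E2" "e 3 = (\<lambda>_. axis 3 1)"
    by (simp_all add: e_def)
  have ev: "heis_E2 p $ 1 = 0" "heis_E2 p $ 2 = 1" "heis_E2 p $ 3 = - p $ 1" for p
    by (simp_all add: heis_E2_def ax)
  have 1: "partial 1 a p = 0" for p
    using E[of 1 p 1] lam al by (simp add: e ev ax)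
  have 2: "dir_deriv heis_E2 b p = 0" for p
    using E[of 2 p 2] al by (simp add: e ev ax)
  have 3: "partial 3 F p = 0" for p
    using E[of 3 p 3] ga by (simp add: e ev ax DF)
  have 4: "dir_deriv heis_E2 a p = - lam\<^sup>2 * partial 1 b p" for p
  proof -
    have "\<alpha> * (dir_deriv heis_E2 a p + lam\<^sup>2 * partial 1 b p) = 0"
      using E[of 1 p 2] lam by (simp add: e ev ax field_simps)
    then show ?thesis using al by simp
  qed
  \<comment> \<open>Pairing with E3 mixes the Q part with the \<theta> part; dividing by
    \<open>\<gamma>\<close> produces the constant \<open>k\<close> of the system.\<close>
  have 5: "partial 1 F p = b p - \<alpha> / (\<gamma> * lam\<^sup>2) * partial 3 a p" for p
    using E[of 1 p 3] lam ga by (simp add: e ev ax DF field_simps)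
  have 6: "dir_deriv heis_E2 F p = - a p - \<alpha> / (\<gamma> * lam\<^sup>2) * lam\<^sup>2 * partial 3 b p" for p
    using E[of 2 p 3] lam ga by (simp add: e ev ax DF field_simps)
  have k: "\<alpha> / (\<gamma> * lam\<^sup>2) \<noteq> 0" "lam\<^sup>2 \<noteq> 0" using lam al ga by simp_all
  note z = heis_killing_system_central_derivatives[OF s(1,2) sF k 1 2 3 4 5 6]
  \<comment> \<open>With the central derivatives of \<open>a\<close> and \<open>b\<close> zero, E2
    acts on them as the y-derivative, and the equations for \<open>F\<close> become those for the
    third component.\<close>
  show ?thesis
    unfolding heis_isometry_field_def nth fun_cong[OF a_def, symmetric]
    using 1 2 3 4 5 6 z
    by (auto simp: DF ax ev dir_deriv_heis_E2 s eq_neg_iff_add_eq_0 add.commute)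
qed

section \<open>Connection and curvature of the metric\<close>

lemma matrix_inv_eqI:
  fixes A B :: "real ^ 'n ^ 'n"
  assumes "A ** B = mat 1"
  shows "matrix_inv A = B"
proof -
  have "B ** A = mat 1" using assms matrix_left_right_inverse by blast
  moreover have "A ** matrix_inv A = mat 1"
    using someI[of "\<lambda>C. A ** C = mat 1 \<and> C ** A = mat 1" B] assms calculation
    by (simp add: matrix_inv_def)
  ultimately show ?thesis by (metis matrix_mul_assoc matrix_mul_lid matrix_mul_rid)
qed

lemma matrix_inv_gram_g2:
  assumes "lam \<noteq> 0"
  shows "matrix_inv (gram (g2 lam) p) =
    vector [vector [lam\<^sup>2, 0, 0], vector [0, 1, - p $ 1], vector [0, - p $ 1, (p $ 1)\<^sup>2 - 1]]"
  by (rule matrix_inv_eqI)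
    (use assms in \<open>simp add: vec_eq_iff forall_3 matrix_matrix_mult_def sum_3 gram_def g2_def mat_def
      axis_def power2_eq_square algebra_simps\<close>)

lemma dir_deriv_g2:
  "dir_deriv X (\<lambda>q. g2 lam q u v) p
    = - (X p $ 1 * (u $ 2 * (p $ 1 * v $ 2 + v $ 3) + (p $ 1 * u $ 2 + u $ 3) * v $ 2))"
proof -
  have hp: "((\<lambda>q::real^3. q $ i) has_derivative (\<lambda>h. h $ i)) (at p)" for i
    by (rule bounded_linear_imp_has_derivative[OF bounded_linear_vec_nth])
  have "((\<lambda>q. g2 lam q u v) has_derivative (\<lambda>h.
      - ((p $ 1 * u $ 2 + u $ 3) * (h $ 1 * v $ 2) + h $ 1 * u $ 2 * (p $ 1 * v $ 2 + v $ 3)))) (at p)"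
    unfolding g2_def by (auto intro!: derivative_eq_intros hp)
  from fun_cong[OF frechet_derivative_at[OF this], symmetric, of "X p"]
  show ?thesis by (simp add: dir_deriv_def algebra_simps)
qed

text \<open>The Christoffel symbols contracted with \<open>u\<close> and \<open>w\<close>, that is,
  the covariant derivative of the constant field \<open>w\<close> along \<open>u\<close>.\<close>

definition g2_gamma :: "real \<Rightarrow> real ^ 3 \<Rightarrow> real ^ 3 \<Rightarrow> real ^ 3 \<Rightarrow> real ^ 3" where
  "g2_gamma lam p u w = vector
    [lam\<^sup>2 / 2 * (2 * p $ 1 * u $ 2 * w $ 2 + u $ 2 * w $ 3 + u $ 3 * w $ 2),
     - (u $ 1 * (p $ 1 * w $ 2 + w $ 3) + w $ 1 * (p $ 1 * u $ 2 + u $ 3)) / 2,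
     (u $ 1 * (((p $ 1)\<^sup>2 + 1) * w $ 2 + p $ 1 * w $ 3) + w $ 1 * (((p $ 1)\<^sup>2 + 1) * u $ 2 + p $ 1 * u $ 3)) / 2]"

lemma levi_civita_g2:
  assumes "lam \<noteq> 0"
  shows "levi_civita (g2 lam) X Y p = dir_deriv X Y p + g2_gamma lam p (X p) (Y p)"
proof -
  have ax: "axis i (1::real) $ j = (if i = j then 1 else 0)" for i j :: 3
    by (simp add: axis_def)
  have "christoffel (g2 lam) k i j p = g2_gamma lam p (axis i 1) (axis j 1) $ k" for k i j
  proof -
    \<comment> \<open>Quantifying over all three indices lets \<open>forall_3\<close> split the
      claim into its 27 explicit cases.\<close>
    have "\<forall>k i j. christoffel (g2 lam) k i j p = g2_gamma lam p (axis i 1) (axis j 1) $ k"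
      unfolding christoffel_def matrix_inv_gram_g2[OF assms]
      by (simp add: forall_3 sum_3 gram_def dir_deriv_g2 g2_gamma_def ax power2_eq_square algebra_simps)
    then show ?thesis by blast
  qed
  then have "(\<chi> k. \<Sum>i\<in>UNIV. \<Sum>j\<in>UNIV. christoffel (g2 lam) k i j p * X p $ i * Y p $ j)
      = g2_gamma lam p (X p) (Y p)"
    by (simp add: vec_eq_iff forall_3 sum_3 g2_gamma_def ax algebra_simps add_divide_distrib diff_divide_distrib)
  then show ?thesis by (simp add: levi_civita_def)
qed

lemma dir_deriv_g2_gamma:
  "dir_deriv X (\<lambda>q. g2_gamma lam q u w) p = X p $ 1 *\<^sub>R vector
    [lam\<^sup>2 * u $ 2 * w $ 2, - (u $ 1 * w $ 2 + w $ 1 * u $ 2) / 2,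
     (u $ 1 * (2 * p $ 1 * w $ 2 + w $ 3) + w $ 1 * (2 * p $ 1 * u $ 2 + u $ 3)) / 2]"
proof -
  define L where "L = (\<lambda>h::real^3. h $ 1 *\<^sub>R vector
    [lam\<^sup>2 * u $ 2 * w $ 2, - (u $ 1 * w $ 2 + w $ 1 * u $ 2) / 2,
     (u $ 1 * (2 * p $ 1 * w $ 2 + w $ 3) + w $ 1 * (2 * p $ 1 * u $ 2 + u $ 3)) / 2] :: real^3)"
  have hp: "((\<lambda>q::real^3. q $ i) has_derivative (\<lambda>h. h $ i)) (at p)" for i
    by (rule bounded_linear_imp_has_derivative[OF bounded_linear_vec_nth])
  have "((\<lambda>q. g2_gamma lam q u w) has_derivative L) (at p)"
    unfolding has_derivative_componentwise_within[of "\<lambda>q. g2_gamma lam q u w"]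
  proof
    fix b :: "real ^ 3" assume "b \<in> Basis"
    then consider "b = axis 1 1" | "b = axis 2 1" | "b = axis 3 1"
      by (auto simp: Basis_vec_def UNIV_3)
    then show "((\<lambda>q. g2_gamma lam q u w \<bullet> b) has_derivative (\<lambda>h. L h \<bullet> b)) (at p)"
      by cases (auto simp: g2_gamma_def L_def inner_axis field_simps
          intro!: derivative_eq_intros hp)
  qed
  from fun_cong[OF frechet_derivative_at[OF this], symmetric, of "X p"]
  show ?thesis by (simp add: dir_deriv_def L_def)
qed

text \<open>Constant fields commute and have zero directional derivative, so only derivatives and
  compositions of the connection coefficients survive.\<close>

lemma curvature_at_g2:
  assumes "lam \<noteq> 0"
  shows "curvature_at (g2 lam) p a u v =
    dir_deriv (\<lambda>_. a) (\<lambda>q. g2_gamma lam q u v) p + g2_gamma lam p a (g2_gamma lam p u v)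
    - (dir_deriv (\<lambda>_. u) (\<lambda>q. g2_gamma lam q a v) p + g2_gamma lam p u (g2_gamma lam p a v))"
proof -
  have c: "dir_deriv Y (\<lambda>_. w) q = 0" for Y :: "3 vfield" and w :: "real ^ 3" and q
    by (simp add: dir_deriv_def frechet_derivative_const)
  have "levi_civita (g2 lam) (\<lambda>_. u) (\<lambda>_. w) = (\<lambda>q. g2_gamma lam q u w)" for u w
    by (rule ext) (simp add: levi_civita_g2[OF assms] c)
  moreover have "lie_bracket (\<lambda>_. a) (\<lambda>_. u) = (\<lambda>_. 0)"
    by (rule ext) (simp add: lie_bracket_def c)
  ultimately show ?thesis
    unfolding curvature_at_def curvature_def
    by (simp only: levi_civita_g2[OF assms]) (simp add: c g2_gamma_def vec_eq_iff forall_3)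
qed

section \<open>Ricci and energy-momentum tensors\<close>

lemma bilinear_heis_tensor: "bilinear (heis_tensor lam \<alpha> \<gamma> p)"
  unfolding bilinear_def linear_iff heis_tensor_def
  by (simp add: algebra_simps add_divide_distrib)

lemma g2_eq_heis_tensor: "g2 lam = heis_tensor lam 1 (- 1)"
  by (rule ext)+ (simp add: g2_def heis_tensor_def)

text \<open>An explicit orthonormal basis exists, so the chosen one is orthonormal and may be
  replaced by it in any trace. The last term is negative because \<partial>_z is timelike.\<close>

lemma sum_some_onb_g2:
  assumes lam: "lam \<noteq> 0" and B: "bilinear B"
  shows "(\<Sum>k\<in>UNIV. g2 lam p (some_onb (g2 lam) p k) (some_onb (g2 lam) p k)
       * B (some_onb (g2 lam) p k) (some_onb (g2 lam) p k))
    = B (vector [lam, 0, 0]) (vector [lam, 0, 0]) + B (vector [0, 1, - p $ 1]) (vector [0, 1, - p $ 1])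
      - B (vector [0, 0, 1]) (vector [0, 0, 1])"
proof -
  have "orthonormal_basis (g2 lam p) (some_onb (g2 lam) p)"
    unfolding some_onb_def
    by (rule someI[of "orthonormal_basis (g2 lam p)", OF g2_orthonormal_basis[OF lam]])
  from orthonormal_basis_trace[OF _ _ B this g2_orthonormal_basis[OF lam]]
  show ?thesis
    using lam by (simp add: g2_eq_heis_tensor bilinear_heis_tensor)
      (simp add: heis_tensor_def sum_3 power2_eq_square algebra_simps)
qed

text \<open>In the coframe \<open>dx\<close>, \<open>dy\<close>, \<open>\<theta> = x dy + dz\<close> the curvature is diagonal on bivectors.\<close>
lemma riemann_g2:
  fixes p :: "real ^ 3"
  assumes "lam \<noteq> 0"
  defines "\<theta> \<equiv> \<lambda>u :: real ^ 3. p $ 1 * u $ 2 + u $ 3"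
  shows "g2 lam p (curvature_at (g2 lam) p e u v) f =
    3 / 4 * ((e $ 1 * u $ 2 - e $ 2 * u $ 1) * (f $ 1 * v $ 2 - f $ 2 * v $ 1))
    + 1 / 4 * ((e $ 1 * \<theta> u - \<theta> e * u $ 1) * (f $ 1 * \<theta> v - \<theta> f * v $ 1))
    + lam\<^sup>2 / 4 * ((e $ 2 * \<theta> u - \<theta> e * u $ 2) * (f $ 2 * \<theta> v - \<theta> f * v $ 2))"
  unfolding curvature_at_g2[OF assms(1)] dir_deriv_g2_gamma
  unfolding g2_def g2_gamma_def \<theta>_def
  by (simp add: field_simps power2_eq_square assms(1))

lemma bilinear_riemann_g2:
  assumes "lam \<noteq> 0"
  shows "bilinear (\<lambda>e f. g2 lam p (curvature_at (g2 lam) p e u v) f)"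
  unfolding bilinear_def linear_iff riemann_g2[OF assms]
  by (simp add: algebra_simps)

lemma ricci_g2:
  assumes "lam \<noteq> 0"
  shows "ricci (g2 lam) = heis_tensor lam (lam\<^sup>2 / 2) (lam\<^sup>2 / 2)"
proof (intro ext)
  fix p u v
  show "ricci (g2 lam) p u v = heis_tensor lam (lam\<^sup>2 / 2) (lam\<^sup>2 / 2) p u v"
    unfolding ricci_def Let_def sum_some_onb_g2[OF assms bilinear_riemann_g2[OF assms]]
    unfolding riemann_g2[OF assms] heis_tensor_def
    by (simp add: field_simps power2_eq_square assms)
qed

lemma energy_momentum_g2:
  assumes "lam \<noteq> 0"
  shows "energy_momentum (g2 lam) = heis_tensor lam (lam\<^sup>2 / 4) (3 * lam\<^sup>2 / 4)"
proof (intro ext)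
  fix p u v
  \<comment> \<open>The two spacelike directions contribute \<open>lam\<^sup>2 / 2\<close> each and
    the timelike one subtracts the same amount.\<close>
  have "scalar_curvature (g2 lam) p = lam\<^sup>2 / 2"
    unfolding scalar_curvature_def Let_def ricci_g2[OF assms]
      sum_some_onb_g2[OF assms bilinear_heis_tensor]
    by (simp add: heis_tensor_def assms power2_eq_square)
  then have "energy_momentum (g2 lam) p u v
      = heis_tensor lam (lam\<^sup>2 / 2) (lam\<^sup>2 / 2) p u v - lam\<^sup>2 / 4 * g2 lam p u v"
    by (simp add: energy_momentum_def ricci_g2[OF assms])
  also have "\<dots> = heis_tensor lam (lam\<^sup>2 / 4) (3 * lam\<^sup>2 / 4) p u v"
    by (simp add: g2_def heis_tensor_def field_simps assms)
  finally show "energy_momentum (g2 lam) p u v = heis_tensor lam (lam\<^sup>2 / 4) (3 * lam\<^sup>2 / 4) p u v" .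
qed

theorem mainTheorem17:
  fixes lam :: real and X :: "3 vfield"
  assumes "lam \<noteq> 0" and "smooth X"
  shows "matter_collineation (g2 lam) X \<longleftrightarrow> killing (g2 lam) X"
proof -
  \<comment> \<open>Both coefficients are nonzero for the metric, 1 and -1, and for the
    energy-momentum tensor, \<open>lam\<^sup>2 / 4\<close> and \<open>3 * lam\<^sup>2 / 4\<close>,
    so both conditions reduce to the same one.\<close>
  have *: "(\<forall>Y Z p. smooth Y \<longrightarrow> smooth Z \<longrightarrow> lie_derivative X (heis_tensor lam \<alpha> \<gamma>) Y Z p = 0)
      \<longleftrightarrow> heis_isometry_field lam X" if "\<alpha> \<noteq> 0" "\<gamma> \<noteq> 0" for \<alpha> \<gamma>
    using heis_isometry_field_imp_lie_derivative[OF assms]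
      lie_derivative_imp_heis_isometry_field[OF assms(1) that assms(2)] by blast
  have "matter_collineation (g2 lam) X \<longleftrightarrow> heis_isometry_field lam X"
    unfolding matter_collineation_def energy_momentum_g2[OF assms(1)]
    by (subst *) (use assms in simp_all)
  moreover have "killing (g2 lam) X \<longleftrightarrow> heis_isometry_field lam X"
    unfolding killing_def g2_eq_heis_tensor by (subst *) (use assms in simp_all)
  ultimately show ?thesis by simp
qed

end
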